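(* Let $P$ be a Markov kernel on a finite state space $S$ with $|S|\ge2$ and stationary distribution $\pi$ of full support. Then $$\eta_{\mathrm{KL}}(P)\ge\max_{x\in S}\frac{D_{\mathrm{KL}}\bigl(P(x,\cdot)\,\|\,\pi\bigr)}{\log(1/\pi(x))}.$$ Equivalently, $\gamma_{\mathrm{KL}}(P)\le 1-\max_{x\in S}\dfrac{D_{\mathrm{KL}}(P(x,\cdot)\|\pi)}{\log(1/\pi(x))}$.
   Context: All logarithms are natural, with $0\log0=0$. $D_{\mathrm{KL}}(\mu\|\nu)=\sum_{x\in S}\mu(x)\log\frac{\mu(x)}{\nu(x)}$ and $(\mu P)(y)=\sum_x\mu(x)P(x,y)$. The KL contraction coefficient is $\eta_{\mathrm{KL}}(P):=\sup_{\mu\ne\pi}D_{\mathrm{KL}}(\mu P\|\pi)/D_{\mathrm{KL}}(\mu\|\pi)$, the supremum being over all probability distributions $\mu\neq\pi$ on $S$; the KL contraction gap is $\gamma_{\mathrm{KL}}(P):=1-\eta_{\mathrm{KL}}(P)$. *)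

theory Defs
  imports "HOL-Probability.Probability"
begin

text \<open>
  A finite state space is a type of class \<open>finite\<close>; a distribution on it is a \<open>pmf\<close>; a Markov
  kernel is a function \<open>P :: 's \<Rightarrow> 's pmf\<close>, with \<open>P(x, y) = pmf (P x) y\<close>. The distribution
  \<open>\<mu>P\<close> is \<open>bind_pmf \<mu> P\<close>.
\<close>

lemma pmf_bind_finite:
  fixes \<mu> :: "'s::finite pmf" and P :: "'s \<Rightarrow> 's pmf"
  shows "pmf (bind_pmf \<mu> P) y = (\<Sum>x\<in>UNIV. pmf \<mu> x * pmf (P x) y)"
  by (simp add: pmf_bind integral_measure_pmf[of UNIV])

definition stationary :: "('s \<Rightarrow> 's pmf) \<Rightarrow> 's pmf \<Rightarrow> bool" where
  "stationary P \<pi> \<longleftrightarrow> bind_pmf \<pi> P = \<pi>"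

text \<open>
  The convention \<open>0 log 0 = 0\<close> holds because the factor \<open>pmf \<mu> x\<close> vanishes. The value is the
  divergence only if \<open>\<nu> x = 0\<close> implies \<open>\<mu> x = 0\<close> (otherwise the divergence is infinite); below,
  \<open>\<nu>\<close> is always a distribution of full support.
\<close>

definition D_KL :: "'s::finite pmf \<Rightarrow> 's pmf \<Rightarrow> real" where
  "D_KL \<mu> \<nu> = (\<Sum>x\<in>UNIV. pmf \<mu> x * ln (pmf \<mu> x / pmf \<nu> x))"

lemma D_KL_eq_KL_divergence:
  fixes \<mu> \<nu> :: "'s::finite pmf"
  assumes "set_pmf \<nu> = UNIV"
  shows "D_KL \<mu> \<nu> = KL_divergence (exp 1) (measure_pmf \<nu>) (measure_pmf \<mu>)"
proof -
  interpret sigma_finite_measure "count_space (UNIV :: 's set)"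
    by (rule sigma_finite_measure_count_space_finite) simp
  have "pmf \<nu> x \<noteq> 0" for x
    using assms by (simp add: pmf_eq_0_set_pmf)
  then have "KL_divergence (exp 1) (density (count_space UNIV) (pmf \<nu>))
      (density (count_space UNIV) (pmf \<mu>))
    = (\<integral>x. pmf \<mu> x * log (exp 1) (pmf \<mu> x / pmf \<nu> x) \<partial>count_space UNIV)"
    by (intro KL_density_density) auto
  then show ?thesis
    by (simp add: D_KL_def lebesgue_integral_count_space_finite log_def
        flip: measure_pmf_eq_density)
qed

text \<open>
  The stationary distribution is an argument, since a reducible kernel has several. The supremum
  is taken in the reals: for \<open>\<pi>\<close> stationary of full support, all ratios lie between 0 and 1 by
  the data-processing inequality, and the set of ratios is nonempty if there are two states.
\<close>

definition eta_KL :: "('s::finite \<Rightarrow> 's pmf) \<Rightarrow> 's pmf \<Rightarrow> real" where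
  "eta_KL P \<pi> = (SUP \<mu>\<in>{\<mu>. \<mu> \<noteq> \<pi>}. D_KL (bind_pmf \<mu> P) \<pi> / D_KL \<mu> \<pi>)"

definition gamma_KL :: "('s::finite \<Rightarrow> 's pmf) \<Rightarrow> 's pmf \<Rightarrow> real" where
  "gamma_KL P \<pi> = 1 - eta_KL P \<pi>"

end

theory Submission
  imports Defs
begin

text \<open>
  At a point mass \<open>\<mu> = \<delta>\<^sub>x\<close> the ratio in the supremum is exactly the ratio on the right. Since the
  supremum is taken in the reals, the ratios must also be bounded above: the tangent line of
  \<open>u ln u\<close> at the likelihood ratio \<open>r = \<mu>P(y) / \<pi>(y)\<close>, summed over the states that lead
  to \<open>y\<close>, gives the data-processing inequality.
\<close>

text \<open>Convexity of u ln u: its tangent at u = \<open>r\<close>, evaluated at u =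
  \<open>a / b\<close> and scaled by \<open>b\<close>. Everything reduces to ln t \<le> t - 1 at t =
  \<open>b * r / a\<close>.\<close>

lemma mult_ln_div_ge_tangent:
  fixes a b r :: real
  assumes "a \<ge> 0" "b > 0" "r > 0"
  shows "a * ln (a / b) \<ge> a * ln r + a - b * r"
proof (cases "a = 0")
  case False
  then have a: "a > 0"
    using assms by simp
  have "ln (b * r / a) \<le> b * r / a - 1"
    using a assms by (intro ln_le_minus_one) simp
  then have "a * ln (b * r / a) \<le> a * (b * r / a - 1)"
    using a by (intro mult_left_mono) auto
  moreover have "ln (b * r / a) = ln r - ln (a / b)"
    using a assms by (simp add: ln_mult ln_div)
  ultimately show ?thesis
    using a by (simp add: algebra_simps)
qed (use assms in simp)

lemma sum_pmf_UNIV: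
  fixes \<mu> :: "'s::finite pmf"
  shows "(\<Sum>x\<in>UNIV. pmf \<mu> x) = 1"
  by (rule sum_pmf_eq_1) auto

text \<open>Gibbs' inequality, from the tangent at 1: its linear terms sum to 1 - 1 = 0. It fixes
  the sign of the denominators in \<open>eta_KL\<close>.\<close>

lemma D_KL_nonneg:
  fixes \<mu> \<nu> :: "'s::finite pmf"
  assumes "set_pmf \<nu> = UNIV"
  shows "D_KL \<mu> \<nu> \<ge> 0"
proof -
  have "pmf \<nu> x > 0" for x
    using assms by (simp add: pmf_positive)
  then have "(\<Sum>x\<in>UNIV. pmf \<mu> x - pmf \<nu> x) \<le> D_KL \<mu> \<nu>"
    unfolding D_KL_def
    using mult_ln_div_ge_tangent[where r = 1] by (intro sum_mono) simp
  then show ?thesis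
    by (simp add: sum_subtractf sum_pmf_UNIV)
qed

lemma D_KL_bind_pmf_le:
  fixes \<mu> \<nu> :: "'s::finite pmf" and P :: "'s \<Rightarrow> 's pmf"
  assumes "set_pmf \<nu> = UNIV" "set_pmf (bind_pmf \<nu> P) = UNIV"
  shows "D_KL (bind_pmf \<mu> P) (bind_pmf \<nu> P) \<le> D_KL \<mu> \<nu>"
proof -
  define q where "q = pmf (bind_pmf \<mu> P)"
  define p where "p = pmf (bind_pmf \<nu> P)"
  have q_eq: "q y = (\<Sum>x\<in>UNIV. pmf \<mu> x * pmf (P x) y)" for y
    by (simp add: q_def pmf_bind_finite)
  have p_eq: "p y = (\<Sum>x\<in>UNIV. pmf \<nu> x * pmf (P x) y)" for y
    by (simp add: p_def pmf_bind_finite)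
  have pos: "pmf \<nu> x > 0" "p x > 0" for x
    using assms by (simp_all add: pmf_positive p_def)
  have le: "q y * ln (q y / p y) \<le> (\<Sum>x\<in>UNIV. pmf \<mu> x * ln (pmf \<mu> x / pmf \<nu> x) * pmf (P x) y)"
    for y
  \<comment> \<open>At \<open>q y = 0\<close> the likelihood ratio is 0 and u ln u has no tangent
    there. But then no state charged by \<open>\<mu>\<close> leads to \<open>y\<close>, so both
    sides vanish.\<close>
  proof (cases "q y = 0")
    case True
    then have "pmf \<mu> x * pmf (P x) y = 0" for x
      unfolding q_eq by (subst (asm) sum_nonneg_eq_0_iff) auto
    then have "(\<Sum>x\<in>UNIV. pmf \<mu> x * ln (pmf \<mu> x / pmf \<nu> x) * pmf (P x) y) = 0"
      by (intro sum.neutral) (metis mult_eq_0_iff)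
    then show ?thesis
      using True by simp
  next
    case False
    \<comment> \<open>This point of tangency makes \<open>p y * r = q y\<close>, so the linear terms
      cancel after summing over \<open>x\<close> and exactly \<open>q y * ln r\<close>
      remains.\<close>
    define r where "r = q y / p y"
    have r: "r > 0"
      using False pos by (simp add: r_def q_def order_less_le)
    have "(\<Sum>x\<in>UNIV. (pmf \<mu> x * ln r + pmf \<mu> x - pmf \<nu> x * r) * pmf (P x) y)
        = q y * ln r + q y - p y * r"
      by (simp add: q_eq p_eq sum.distrib sum_subtractf algebra_simps flip: sum_distrib_left)
    moreover have "p y * r = q y"
      using pos(2)[of y] by (simp add: r_def)
    ultimately have "q y * ln r
        = (\<Sum>x\<in>UNIV. (pmf \<mu> x * ln r + pmf \<mu> x - pmf \<nu> x * r) * pmf (P x) y)"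
      by simp
    also have "\<dots> \<le> (\<Sum>x\<in>UNIV. pmf \<mu> x * ln (pmf \<mu> x / pmf \<nu> x) * pmf (P x) y)"
      using pos r by (intro sum_mono mult_right_mono mult_ln_div_ge_tangent) auto
    finally show ?thesis
      by (simp add: r_def)
  qed
  have "D_KL (bind_pmf \<mu> P) (bind_pmf \<nu> P) = (\<Sum>y\<in>UNIV. q y * ln (q y / p y))"
    by (simp add: D_KL_def q_def p_def)
  also have "\<dots> \<le> (\<Sum>y\<in>UNIV. \<Sum>x\<in>UNIV. pmf \<mu> x * ln (pmf \<mu> x / pmf \<nu> x) * pmf (P x) y)"
    by (intro sum_mono le)
  \<comment> \<open>Summing over the target first leaves the row sums of \<open>P\<close>, which are
    1.\<close>
  also have "\<dots> = (\<Sum>x\<in>UNIV. pmf \<mu> x * ln (pmf \<mu> x / pmf \<nu> x) * (\<Sum>y\<in>UNIV. pmf (P x) y))"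
    by (subst sum.swap) (simp add: sum_distrib_left)
  also have "\<dots> = D_KL \<mu> \<nu>"
    by (simp add: sum_pmf_UNIV D_KL_def)
  finally show ?thesis .
qed

lemma D_KL_return_pmf:
  fixes \<nu> :: "'s::finite pmf"
  shows "D_KL (return_pmf x) \<nu> = ln (1 / pmf \<nu> x)"
proof -
  have "D_KL (return_pmf x) \<nu> = (\<Sum>y\<in>UNIV. if y = x then ln (1 / pmf \<nu> x) else 0)"
    unfolding D_KL_def by (intro sum.cong) (auto simp: indicator_def)
  then show ?thesis
    by simp
qed

theorem theorem2p1:
  fixes P :: "'s::finite \<Rightarrow> 's pmf" and \<pi> :: "'s pmf"
  assumes "CARD('s) \<ge> 2"
    and "stationary P \<pi>"
    and "set_pmf \<pi> = UNIV"
  shows "eta_KL P \<pi> \<ge> (MAX x\<in>UNIV. D_KL (P x) \<pi> / ln (1 / pmf \<pi> x))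
    \<and> gamma_KL P \<pi> \<le> 1 - (MAX x\<in>UNIV. D_KL (P x) \<pi> / ln (1 / pmf \<pi> x))"
proof -
  \<comment> \<open>Stationarity turns the second argument \<open>bind_pmf \<pi> P\<close> into
    \<open>\<pi>\<close>. A zero denominator is harmless, since the quotient is then 0.\<close>
  have "D_KL (bind_pmf \<mu> P) \<pi> / D_KL \<mu> \<pi> \<le> 1" for \<mu>
    using D_KL_bind_pmf_le[of \<pi> P \<mu>] D_KL_nonneg[of \<pi> \<mu>] assms
    by (auto simp: stationary_def divide_le_eq_1 order_less_le simp del: set_bind_pmf)
  then have bdd: "bdd_above ((\<lambda>\<mu>. D_KL (bind_pmf \<mu> P) \<pi> / D_KL \<mu> \<pi>) ` {\<mu>. \<mu> \<noteq> \<pi>})"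
    by (intro bdd_aboveI2)
  have "D_KL (P x) \<pi> / ln (1 / pmf \<pi> x) \<le> eta_KL P \<pi>" for x
  proof -
    \<comment> \<open>The point mass must be admissible in the supremum; with two or more states it
      lacks full support.\<close>
    have "return_pmf x \<noteq> \<pi>"
    proof
      assume "return_pmf x = \<pi>"
      with assms(3) have "(UNIV :: 's set) = {x}"
        by (metis set_return_pmf)
      then have "CARD('s) = card {x}"
        by simp
      with assms(1) show False
        by simp
    qed
    then have "D_KL (bind_pmf (return_pmf x) P) \<pi> / D_KL (return_pmf x) \<pi> \<le> eta_KL P \<pi>"
      unfolding eta_KL_def by (intro cSUP_upper[OF _ bdd]) simp
    then show ?thesis
      by (simp add: D_KL_return_pmf bind_return_pmf)
  qed
  then have "(MAX x\<in>UNIV. D_KL (P x) \<pi> / ln (1 / pmf \<pi> x)) \<le> eta_KL P \<pi>"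
    by (subst Max_le_iff) auto
  then show ?thesis
    by (simp add: gamma_KL_def)
qed

end
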